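(* Let $X$ be a finite set of positive integers such that $\mathcal{G}(X)$ is connected. The induced map $\eta_*$ is well defined on edge-paths up to homotopy: if $\mathcal{L}_0$ and $\mathcal{L}_1$ are homotopic edge-paths in $\mathcal{G}(X)$, and $\eta_*(\mathcal{L}_0)$ and $\eta_*(\mathcal{L}_1)$ are formed with choices for which they have the same first vertex and the same last vertex, then $\eta_*(\mathcal{L}_0)$ and $\eta_*(\mathcal{L}_1)$ are homotopic edge-paths in $\mathcal{D}(X)$.
   Context: An (abstract) simplicial complex is a pair $(\mathcal{V},\mathcal{S})$ with $\mathcal{V}$ a finite set of vertices and $\mathcal{S}$ a set of nonempty subsets of $\mathcal{V}$ (the simplices), containing all singletons and closed under taking nonempty subsets. For a set $X$ of positive integers put $X^*=X\setminus\{1\}$. The common divisor simplicial complex $\mathcal{G}(X)$ has vertex set $X^*$, and a nonempty $V\subseteq X^*$ is a simplex iff $\gcd(V)>1$. The prime divisor simplicial complex $\mathcal{D}(X)$ has as vertices the primes dividing at least one element of $X^*$, and a nonempty set $Q$ of such primes is a simplex iff some $v\in X$ is divisible by every element of $Q$. For a simplex $\sigma$ of $\mathcal{G}(X)$, $\eta(\sigma)$ is the simplex of $\mathcal{D}(X)$ whose vertices are the primes dividing $\gcd(\sigma)$. Edge-paths. In a simplicial complex, an edge-path $\langle v_1,v_2\rangle\langle v_2,v_3\rangle\cdots\langle v_{n-1},v_n\rangle$ ($n\ge 2$) is a sequence of vertices $v_1,\dots,v_n$ such that each $\{v_i,v_{i+1}\}$ is a simplex ($v_i=v_{i+1}$ is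 allowed). A simple equivalence replaces a segment $\langle v,w\rangle$ of an edge-path by $\langle v,u\rangle\langle u,w\rangle$, or vice versa, where $u,v,w$ are not necessarily distinct vertices contained in a common simplex. Two edge-paths are homotopic if one is obtained from the other by finitely many simple equivalences (so homotopic edge-paths have the same endpoints). The induced map. For an edge-path $\mathcal{L}=\langle v_1,v_2\rangle\cdots\langle v_{n-1},v_n\rangle$ in $\mathcal{G}(X)$, choose for each $1\le i\le n-1$ a vertex $\omega_i$ of $\eta(\{v_i,v_{i+1}\})$ (a prime dividing $v_i$ and $v_{i+1}$) and a vertex $\omega_n$ of $\eta(\{v_n\})$ (a prime dividing $v_n$), and set $\eta_*(\mathcal{L})=\langle\omega_1,\omega_2\rangle\cdots\langle\omega_{n-1},\omega_n\rangle$, an edge-path in $\mathcal{D}(X)$. If $\mathcal{L}$ is an edge-loop ($v_1=v_n$), one chooses $\omega_n=\omega_1$. *)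

theory Defs
  imports "HOL-Computational_Algebra.Primes"
begin

text \<open>Abstract simplicial complexes, given as a pair of a vertex set and a set of simplices.\<close>

type_synonym 'a scomplex = "'a set \<times> 'a set set"

definition vertices :: "'a scomplex \<Rightarrow> 'a set" where
  "vertices K = fst K"

definition simplices :: "'a scomplex \<Rightarrow> 'a set set" where
  "simplices K = snd K"

definition abstract_simplicial_complex :: "'a scomplex \<Rightarrow> bool" where
  "abstract_simplicial_complex K \<longleftrightarrow>
     finite (vertices K) \<and>
     (\<forall>\<sigma> \<in> simplices K. \<sigma> \<noteq> {} \<and> \<sigma> \<subseteq> vertices K) \<and>
     (\<forall>v \<in> vertices K. {v} \<in> simplices K) \<and>
     (\<forall>\<sigma> \<in> simplices K. \<forall>\<tau>. \<tau> \<noteq> {} \<and> \<tau> \<subseteq> \<sigma> \<longrightarrow> \<tau> \<in> simplices K)"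

text \<open>
  The edge-path \<open>\<langle>v\<^sub>1,v\<^sub>2\<rangle>\<langle>v\<^sub>2,v\<^sub>3\<rangle>\<dots>\<langle>v\<^sub>n\<^sub>-\<^sub>1,v\<^sub>n\<rangle>\<close>, \<open>n \<ge> 2\<close>, is represented by the list
  \<open>[v\<^sub>1, \<dots>, v\<^sub>n]\<close> of its vertices; list positions start at 0.
\<close>

definition edge_path :: "'a scomplex \<Rightarrow> 'a list \<Rightarrow> bool" where
  "edge_path K L \<longleftrightarrow>
     length L \<ge> 2 \<and> set L \<subseteq> vertices K \<and>
     (\<forall>i. Suc i < length L \<longrightarrow> {L ! i, L ! Suc i} \<in> simplices K)"

text \<open>
  Connectedness means that any two vertices are joined by an edge-path; as for topological spaces,
  the empty complex counts as connected.
\<close>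

definition connected_complex :: "'a scomplex \<Rightarrow> bool" where
  "connected_complex K \<longleftrightarrow>
     (\<forall>v \<in> vertices K. \<forall>w \<in> vertices K. \<exists>L. edge_path K L \<and> hd L = v \<and> last L = w)"

text \<open>Replacement of one segment \<open>\<langle>v,w\<rangle>\<close> by \<open>\<langle>v,u\<rangle>\<langle>u,w\<rangle>\<close>.\<close>

definition edge_expansion :: "'a scomplex \<Rightarrow> 'a list \<Rightarrow> 'a list \<Rightarrow> bool" where
  "edge_expansion K L L' \<longleftrightarrow>
     (\<exists>xs ys u v w. L = xs @ [v, w] @ ys \<and> L' = xs @ [v, u, w] @ ys \<and>
        (\<exists>\<sigma> \<in> simplices K. {u, v, w} \<subseteq> \<sigma>))"

definition simple_equivalence :: "'a scomplex \<Rightarrow> 'a list \<Rightarrow> 'a list \<Rightarrow> bool" where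
  "simple_equivalence K L L' \<longleftrightarrow> edge_expansion K L L' \<or> edge_expansion K L' L"

text \<open>
  Simple equivalences turn edge-paths into edge-paths, so it suffices to require that the two ends
  of the chain are edge-paths.
\<close>

definition homotopic_edge_paths :: "'a scomplex \<Rightarrow> 'a list \<Rightarrow> 'a list \<Rightarrow> bool" where
  "homotopic_edge_paths K L L' \<longleftrightarrow>
     edge_path K L \<and> edge_path K L' \<and> (simple_equivalence K)\<^sup>*\<^sup>* L L'"

definition common_divisor_complex :: "nat set \<Rightarrow> nat scomplex" where
  "common_divisor_complex X =
     (X - {1}, {V. V \<noteq> {} \<and> V \<subseteq> X - {1} \<and> Gcd V > 1})"

definition prime_divisor_complex :: "nat set \<Rightarrow> nat scomplex" where
  "prime_divisor_complex X =
     (let P = {p. prime p \<and> (\<exists>x \<in> X - {1}. p dvd x)}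
      in (P, {Q. Q \<noteq> {} \<and> Q \<subseteq> P \<and> (\<exists>v \<in> X. \<forall>q \<in> Q. q dvd v)}))"

definition eta :: "nat set \<Rightarrow> nat set" where
  "eta \<sigma> = {p. prime p \<and> p dvd Gcd \<sigma>}"

text \<open>
  \<open>eta_star L W\<close> says that \<open>W\<close> is one of the possible values of \<open>\<eta>\<^sub>*(L)\<close>, that is, the edge-path
  formed from \<open>L = [v\<^sub>1, \<dots>, v\<^sub>n]\<close> with some admissible choice \<open>W = [\<omega>\<^sub>1, \<dots>, \<omega>\<^sub>n]\<close>.  The last
  conjunct is the convention \<open>\<omega>\<^sub>n = \<omega>\<^sub>1\<close> for edge-loops.
\<close>

definition eta_star :: "nat list \<Rightarrow> nat list \<Rightarrow> bool" where
  "eta_star L W \<longleftrightarrow>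
     length W = length L \<and>
     (\<forall>i. Suc i < length L \<longrightarrow> W ! i \<in> eta {L ! i, L ! Suc i}) \<and>
     last W \<in> eta {last L} \<and>
     (hd L = last L \<longrightarrow> last W = hd W)"

lemma abstract_simplicial_complex_common_divisor:
  assumes "finite X" "\<forall>x \<in> X. x > 0"
  shows "abstract_simplicial_complex (common_divisor_complex X)"
proof -
  have "Gcd \<tau> > 1" if "Gcd \<sigma> > 1" "\<tau> \<noteq> {}" "\<tau> \<subseteq> \<sigma>" "\<sigma> \<subseteq> X" for \<sigma> \<tau> :: "nat set"
  proof -
    obtain t where t: "t \<in> \<tau>" using \<open>\<tau> \<noteq> {}\<close> by blast
    then have "t > 0" using that assms by blast
    then have "Gcd \<tau> > 0" using Gcd_dvd[OF t] by (auto intro: Nat.gr0I)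
    moreover have "Gcd \<sigma> dvd Gcd \<tau>" using that by (intro Gcd_greatest Gcd_dvd) auto
    ultimately show ?thesis using that(1) dvd_imp_le order_less_le_trans by blast
  qed
  moreover have "x > 1" if "x \<in> X - {1}" for x using that assms by (cases x) auto
  ultimately show ?thesis
    using assms(1)
    unfolding abstract_simplicial_complex_def common_divisor_complex_def vertices_def simplices_def
    by auto
qed

lemma abstract_simplicial_complex_prime_divisor:
  assumes "finite X" "\<forall>x \<in> X. x > 0"
  shows "abstract_simplicial_complex (prime_divisor_complex X)"
proof -
  let ?P = "{p. prime p \<and> (\<exists>x \<in> X - {1}. p dvd x)}"
  have "?P \<subseteq> (\<Union>x \<in> X. {..x})" using assms(2) dvd_imp_le by fastforce
  then have "finite ?P" using assms(1) by (meson finite_UN finite_atMost finite_subset)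
  then show ?thesis
    unfolding abstract_simplicial_complex_def prime_divisor_complex_def vertices_def simplices_def
      Let_def
    by auto
qed

end

theory Submission
  imports Defs
begin

text \<open>
  The primes dividing a fixed element of \<open>X - {1}\<close> span a simplex of the prime divisor complex.
  If \<open>W\<close> is a value of \<open>\<eta>\<^sub>*(L)\<close>, then consecutive entries of \<open>W\<close> divide a common vertex of \<open>L\<close>,
  so each vertex of \<open>L\<close> provides a simplex of primes through which \<open>W\<close> passes; this gives
  room to move \<open>W\<close>.

  One difficulty is that a simple equivalence at the beginning of \<open>L\<close> may force the first prime of
  \<open>W\<close> to change, because that prime has to divide the first two vertices of \<open>L\<close>; so the homotopy
  cannot be followed within the values of \<open>\<eta>\<^sub>*\<close> while the end points stay fixed.  The remedy
  is to put an additional prime in front.  A list \<open>P\<close> of primes \<^emph>\<open>threads\<close> a list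
  \<open>L = [v\<^sub>1, \<dots>, v\<^sub>n]\<close> if \<open>P = [p\<^sub>0, \<dots>, p\<^sub>n]\<close> and both \<open>p\<^sub>i\<^sub>-\<^sub>1\<close> and \<open>p\<^sub>i\<close> divide \<open>v\<^sub>i\<close>.  Now the end
  points \<open>p\<^sub>0\<close> and \<open>p\<^sub>n\<close> are constrained only by the end points of \<open>L\<close>, which homotopies fix.

  Two facts carry the proof.  By \<open>threads_unique\<close>, two threadings of the same \<open>L\<close> with the same end
  points are homotopic: exchange the interior primes one at a time.  By
  \<open>threads_simple_equivalence\<close>, a simple equivalence from \<open>L\<close> to \<open>L'\<close> lifts to a homotopy
  from any threading of \<open>L\<close> to some threading of \<open>L'\<close>: a simplex containing \<open>u\<close>, \<open>v\<close>, \<open>w\<close> supplies a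
  prime \<open>r\<close> dividing all three, and all primes interior to the segment can be replaced by \<open>r\<close>.
  Finally, \<open>W\<close> is homotopic to \<open>hd W # W\<close>, which threads \<open>L\<close>.
\<close>

section \<open>Simple equivalences in an arbitrary complex\<close>

lemma simple_equivalence_sym: "simple_equivalence K L L' \<Longrightarrow> simple_equivalence K L' L"
  by (auto simp: simple_equivalence_def)

lemma simple_equivalences_sym:
  assumes "(simple_equivalence K)\<^sup>*\<^sup>* L L'"
  shows "(simple_equivalence K)\<^sup>*\<^sup>* L' L"
  using assms
proof (induction rule: rtranclp_induct)
  case (step M N)
  then show ?case by (meson converse_rtranclp_into_rtranclp simple_equivalence_sym)
qed simp

lemma edge_expansion_in_context:
  assumes "edge_expansion K L L'"
  shows "edge_expansion K (A @ L @ B) (A @ L' @ B)"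
proof -
  obtain xs ys u v w where L: "L = xs @ [v, w] @ ys" "L' = xs @ [v, u, w] @ ys"
    and \<sigma>: "\<exists>\<sigma> \<in> simplices K. {u, v, w} \<subseteq> \<sigma>"
    using assms unfolding edge_expansion_def by (elim exE conjE) (rule that)
  show ?thesis
    unfolding edge_expansion_def
  proof (intro exI conjI)
    show "A @ L @ B = (A @ xs) @ [v, w] @ (ys @ B)" "A @ L' @ B = (A @ xs) @ [v, u, w] @ (ys @ B)"
      using L by simp_all
  qed (rule \<sigma>)
qed

lemma simple_equivalences_in_context:
  assumes "(simple_equivalence K)\<^sup>*\<^sup>* L L'"
  shows "(simple_equivalence K)\<^sup>*\<^sup>* (A @ L @ B) (A @ L' @ B)"
  using assms
proof (induction rule: rtranclp_induct)
  case (step M N)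
  then have "simple_equivalence K (A @ M @ B) (A @ N @ B)"
    unfolding simple_equivalence_def using edge_expansion_in_context by metis
  with step.IH show ?case by (rule rtranclp.rtrancl_into_rtrancl)
qed simp

lemma simple_equivalences_same_ends:
  assumes "(simple_equivalence K)\<^sup>*\<^sup>* L L'"
  shows "hd L' = hd L \<and> last L' = last L"
  using assms
proof (induction rule: rtranclp_induct)
  case (step M N)
  have "hd N = hd M \<and> last N = last M"
    using step.hyps(2) unfolding simple_equivalence_def edge_expansion_def
    by (auto simp: hd_append)
  with step.IH show ?case by simp
qed simp

lemma simple_equivalence_insert:
  assumes "\<sigma> \<in> simplices K" "{a, b, c} \<subseteq> \<sigma>"
  shows "simple_equivalence K [a, c] [a, b, c]"
proof -
  have "[a, c] = [] @ [a, c] @ []" "[a, b, c] = [] @ [a, b, c] @ []" "{b, a, c} \<subseteq> \<sigma>"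
    using assms(2) by auto
  then show ?thesis
    unfolding simple_equivalence_def edge_expansion_def using assms(1) by blast
qed

text \<open>
  Insert \<open>c\<close> before \<open>b\<close>, then delete \<open>b\<close>.  In this way \<open>{a, b, c}\<close> and \<open>{b, c, d}\<close> may lie in
  different simplices.
\<close>

lemma simple_equivalences_exchange:
  assumes "\<sigma> \<in> simplices K" "{a, b, c} \<subseteq> \<sigma>" and "\<tau> \<in> simplices K" "{b, c, d} \<subseteq> \<tau>"
  shows "(simple_equivalence K)\<^sup>*\<^sup>* [a, b, d] [a, c, d]"
proof -
  have 1: "simple_equivalence K [a, b] [a, c, b]"
    by (rule simple_equivalence_insert[OF assms(1)]) (use assms(2) in auto)
  have 2: "simple_equivalence K [c, d] [c, b, d]"
    by (rule simple_equivalence_insert[OF assms(3)]) (use assms(4) in auto)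
  have "(simple_equivalence K)\<^sup>*\<^sup>* [a, b, d] [a, c, b, d]"
    using simple_equivalences_in_context[OF r_into_rtranclp[of "simple_equivalence K", OF 1], of "[]" "[d]"]
    by simp
  also have "(simple_equivalence K)\<^sup>*\<^sup>* [a, c, b, d] [a, c, d]"
    using simple_equivalences_in_context[OF r_into_rtranclp[of "simple_equivalence K",
        OF simple_equivalence_sym[OF 2]], of "[a]" "[]"]
    by simp
  finally show ?thesis .
qed

section \<open>Paths of primes threading a path of integers\<close>

lemma prime_divisors_simplex:
  assumes "v \<in> X - {1}" "Q \<noteq> {}" "\<And>q. q \<in> Q \<Longrightarrow> prime q \<and> q dvd v"
  shows "Q \<in> simplices (prime_divisor_complex X)"
  using assms unfolding simplices_def prime_divisor_complex_def Let_def by auto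

text \<open>
  Allowing the empty list, threaded by any single number, makes \<open>threads\<close> split at every position
  of \<open>L\<close>, including both ends.
\<close>

fun threads :: "nat set \<Rightarrow> nat list \<Rightarrow> nat list \<Rightarrow> bool" where
  "threads X [] P \<longleftrightarrow> (\<exists>a. P = [a])"
| "threads X (v # L) P \<longleftrightarrow>
     (\<exists>a b R. P = a # b # R \<and> v \<in> X - {1} \<and> prime a \<and> a dvd v \<and> prime b \<and> b dvd v \<and>
        threads X L (b # R))"

lemma threads_append:
  "threads X (L @ M) P \<longleftrightarrow>
     (\<exists>A a B. P = A @ a # B \<and> threads X L (A @ [a]) \<and> threads X M (a # B))"
proof (induction L arbitrary: P)
  case Nil
  have "threads X M P \<Longrightarrow> P \<noteq> []" by (cases M) auto
  then show ?case by (auto simp: neq_Nil_conv)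
next
  case (Cons v L)
  show ?case
  proof
    assume "threads X ((v # L) @ M) P"
    then obtain p b R where P: "P = p # b # R" and v: "v \<in> X - {1}" "prime p" "p dvd v"
        "prime b" "b dvd v" and "threads X (L @ M) (b # R)"
      by auto
    then obtain A a B where split: "b # R = A @ a # B" "threads X L (A @ [a])" "threads X M (a # B)"
      using Cons.IH by blast
    from split(1) obtain T where "A @ [a] = b # T" by (cases A) auto
    then have "threads X (v # L) ((p # A) @ [a])" using v split(2) by auto
    moreover have "P = (p # A) @ a # B" using P split(1) by simp
    ultimately show "\<exists>A a B. P = A @ a # B \<and> threads X (v # L) (A @ [a]) \<and> threads X M (a # B)"
      using split(3) by blast
  next
    assume "\<exists>A a B. P = A @ a # B \<and> threads X (v # L) (A @ [a]) \<and> threads X M (a # B)"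
    then obtain A a B where P: "P = A @ a # B" and "threads X (v # L) (A @ [a])"
        and M: "threads X M (a # B)"
      by blast
    then obtain p b R where A: "A @ [a] = p # b # R" and v: "v \<in> X - {1}" "prime p" "p dvd v"
        "prime b" "b dvd v" and L: "threads X L (b # R)"
      by auto
    from A obtain A' where A': "A = p # A'" "A' @ [a] = b # R" by (cases A) auto
    then have "threads X (L @ M) (A' @ a # B)" using L M Cons.IH by metis
    moreover have "A' @ a # B = b # (R @ B)"
      using A'(2) by (metis append_Cons append_Nil append_assoc)
    ultimately have "P = p # b # (R @ B)" "threads X (L @ M) (b # (R @ B))"
      using P A'(1) by simp_all
    then show "threads X ((v # L) @ M) P" using v by auto
  qed
qed

text \<open>
  A prime between two vertices of \<open>L\<close> may be exchanged for any other prime dividing both, since the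
  primes dividing either vertex span a simplex.  Doing this from left to right turns one threading
  into the other.
\<close>

lemma threads_unique:
  assumes "threads X L P" "threads X L Q" "hd P = hd Q" "last P = last Q"
  shows "(simple_equivalence (prime_divisor_complex X))\<^sup>*\<^sup>* P Q"
  using assms
proof (induction L arbitrary: P Q)
  case Nil
  then show ?case by auto
next
  case (Cons v L)
  let ?D = "prime_divisor_complex X"
  obtain a b P' where P: "P = a # b # P'" and v: "v \<in> X - {1}" "prime a" "a dvd v"
      "prime b" "b dvd v" and LP: "threads X L (b # P')"
    using Cons.prems(1) by auto
  obtain c Q' where Q: "Q = a # c # Q'" "prime c" "c dvd v" and LQ: "threads X L (c # Q')"
    using Cons.prems(2,3) P by auto
  show ?case
  proof (cases L)
    case Nil
    then show ?thesis using LP LQ P Q Cons.prems(4) by auto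
  next
    case (Cons x L')
    then obtain d R where R: "P' = d # R" "x \<in> X - {1}" "prime b" "b dvd x" "prime d" "d dvd x"
        "threads X L' (d # R)"
      using LP by auto
    have c: "prime c" "c dvd x" using LQ Cons by auto
    have "{a, b, c} \<in> simplices ?D" "{b, c, d} \<in> simplices ?D"
      using v Q R c by (auto intro: prime_divisors_simplex[of v] prime_divisors_simplex[of x])
    then have "(simple_equivalence ?D)\<^sup>*\<^sup>* [a, b, d] [a, c, d]"
      by (blast intro: simple_equivalences_exchange)
    then have "(simple_equivalence ?D)\<^sup>*\<^sup>* P (a # c # P')"
      using simple_equivalences_in_context[of ?D "[a, b, d]" "[a, c, d]" "[]" R] P R(1) by simp
    moreover have "(simple_equivalence ?D)\<^sup>*\<^sup>* (c # P') (c # Q')"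
      using Cons.IH[of "c # P'" "c # Q'"] LQ R c Cons Cons.prems(4) P Q(1) by (auto split: if_splits)
    then have "(simple_equivalence ?D)\<^sup>*\<^sup>* (a # c # P') Q"
      using simple_equivalences_in_context[of ?D "c # P'" "c # Q'" "[a]" "[]"] Q(1) by simp
    ultimately show ?thesis by (rule rtranclp_trans)
  qed
qed

text \<open>
  Let \<open>r\<close> be a prime dividing all of the simplex \<open>{u, v, w}\<close>.  A threading that passes \<open>v, w\<close> as
  \<open>a, b, d\<close> moves to \<open>a, r, d\<close> and then to \<open>a, r, r, d\<close>, which threads \<open>v, u, w\<close>; the repeated
  \<open>r\<close> is possible because \<open>r\<close> divides \<open>u\<close>.  Conversely, a threading that passes \<open>v, u, w\<close> as
  \<open>a, b, c, d\<close> moves to \<open>a, r, c, d\<close> and then to \<open>a, r, d\<close>, which threads \<open>v, w\<close> because \<open>r\<close>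
  divides both \<open>v\<close> and \<open>w\<close>.
\<close>

lemma threads_simple_equivalence:
  assumes "simple_equivalence (common_divisor_complex X) L L'" "threads X L P"
  shows "\<exists>P'. threads X L' P' \<and> (simple_equivalence (prime_divisor_complex X))\<^sup>*\<^sup>* P P'"
proof -
  let ?D = "prime_divisor_complex X"
  have prime: "\<exists>r. prime r \<and> r dvd u \<and> r dvd v \<and> r dvd w \<and> u \<in> X - {1}"
    if \<sigma>: "\<exists>\<sigma> \<in> simplices (common_divisor_complex X). {u, v, w} \<subseteq> \<sigma>" for u v w
  proof -
    obtain \<sigma> where "{u, v, w} \<subseteq> \<sigma>" "\<sigma> \<subseteq> X - {1}" "Gcd \<sigma> > 1"
      using \<sigma> unfolding simplices_def common_divisor_complex_def by auto
    moreover from this obtain r where "prime r" "r dvd Gcd \<sigma>"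
      using prime_factor_nat[of "Gcd \<sigma>"] by auto
    ultimately show ?thesis by (meson Gcd_dvd dvd_trans insert_subset subsetD)
  qed
  consider "edge_expansion (common_divisor_complex X) L L'"
    | "edge_expansion (common_divisor_complex X) L' L"
    using assms(1) unfolding simple_equivalence_def by blast
  then show ?thesis
  proof cases
    case 1
    then obtain xs ys u v w where L: "L = xs @ [v, w] @ ys" "L' = xs @ [v, u, w] @ ys"
        and \<sigma>: "\<exists>\<sigma> \<in> simplices (common_divisor_complex X). {u, v, w} \<subseteq> \<sigma>"
      unfolding edge_expansion_def by (elim exE conjE) (rule that)
    from prime[OF \<sigma>] obtain r where r: "prime r" "r dvd u" "r dvd v" "r dvd w" "u \<in> X - {1}"
      by blast
    obtain A a R where A: "P = A @ a # R" "threads X xs (A @ [a])" "threads X ([v, w] @ ys) (a # R)"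
      using assms(2) unfolding L threads_append[of X xs] by (elim exE conjE) (rule that)
    from A(3) obtain b d B where R: "R = b # d # B" and ys: "threads X ys (d # B)"
        and div: "v \<in> X - {1}" "w \<in> X - {1}" "prime a" "prime b" "prime d"
        "a dvd v" "b dvd v" "b dvd w" "d dvd w"
      by auto
    have P: "P = A @ [a, b, d] @ B" using A(1) R by simp
    have "threads X ([v, u, w] @ ys) (a # r # r # d # B)"
      using ys r div by simp
    then have "threads X L' (A @ a # r # r # d # B)"
      unfolding L threads_append[of X xs] using A(2) by blast
    then have "threads X L' (A @ [a, r, r, d] @ B)" by simp
    moreover have "(simple_equivalence ?D)\<^sup>*\<^sup>* [a, b, d] [a, r, r, d]"
    proof -
      have "{a, b, r} \<in> simplices ?D" "{b, r, d} \<in> simplices ?D" "{r, r, d} \<in> simplices ?D"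
        using r div by (auto intro: prime_divisors_simplex[of v] prime_divisors_simplex[of w])
      then have "(simple_equivalence ?D)\<^sup>*\<^sup>* [a, b, d] [a, r, d]"
        and 1: "simple_equivalence ?D [r, d] [r, r, d]"
        by (blast intro: simple_equivalences_exchange simple_equivalence_insert)+
      note this(1)
      also have "(simple_equivalence ?D)\<^sup>*\<^sup>* [a, r, d] [a, r, r, d]"
        using simple_equivalences_in_context[OF r_into_rtranclp[of "simple_equivalence ?D", OF 1],
            of "[a]" "[]"]
        by simp
      finally show ?thesis .
    qed
    ultimately show ?thesis unfolding P by (blast intro: simple_equivalences_in_context)
  next
    case 2
    then obtain xs ys u v w where L: "L' = xs @ [v, w] @ ys" "L = xs @ [v, u, w] @ ys"
        and \<sigma>: "\<exists>\<sigma> \<in> simplices (common_divisor_complex X). {u, v, w} \<subseteq> \<sigma>"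
      unfolding edge_expansion_def by (elim exE conjE) (rule that)
    from prime[OF \<sigma>] obtain r where r: "prime r" "r dvd u" "r dvd v" "r dvd w" "u \<in> X - {1}"
      by blast
    obtain A a R where A: "P = A @ a # R" "threads X xs (A @ [a])" "threads X ([v, u, w] @ ys) (a # R)"
      using assms(2) unfolding L threads_append[of X xs] by (elim exE conjE) (rule that)
    from A(3) obtain b c d B where R: "R = b # c # d # B" and ys: "threads X ys (d # B)"
        and div: "v \<in> X - {1}" "w \<in> X - {1}" "prime a" "prime b" "prime c"
        "prime d" "a dvd v" "b dvd v" "b dvd u" "c dvd u" "c dvd w" "d dvd w"
      by auto
    have P: "P = A @ [a, b, c, d] @ B" using A(1) R by simp
    have "threads X ([v, w] @ ys) (a # r # d # B)"
      using ys r div by simp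
    then have "threads X L' (A @ a # r # d # B)"
      unfolding L threads_append[of X xs] using A(2) by blast
    then have "threads X L' (A @ [a, r, d] @ B)" by simp
    moreover have "(simple_equivalence ?D)\<^sup>*\<^sup>* [a, b, c, d] [a, r, d]"
    proof -
      have "{a, b, r} \<in> simplices ?D" "{b, r, c} \<in> simplices ?D" "{r, c, d} \<in> simplices ?D"
        using r div by (auto intro: prime_divisors_simplex[of v] prime_divisors_simplex[of u]
            prime_divisors_simplex[of w])
      then have 1: "(simple_equivalence ?D)\<^sup>*\<^sup>* [a, b, c] [a, r, c]"
        and 2: "simple_equivalence ?D [r, c, d] [r, d]"
        by (blast intro: simple_equivalences_exchange simple_equivalence_insert
            simple_equivalence_sym)+
      have "(simple_equivalence ?D)\<^sup>*\<^sup>* [a, b, c, d] [a, r, c, d]"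
        using simple_equivalences_in_context[OF 1, of "[]" "[d]"] by simp
      also have "(simple_equivalence ?D)\<^sup>*\<^sup>* [a, r, c, d] [a, r, d]"
        using simple_equivalences_in_context[OF r_into_rtranclp[of "simple_equivalence ?D", OF 2],
            of "[a]" "[]"]
        by simp
      finally show ?thesis .
    qed
    ultimately show ?thesis unfolding P by (blast intro: simple_equivalences_in_context)
  qed
qed

lemma threads_simple_equivalences:
  assumes "(simple_equivalence (common_divisor_complex X))\<^sup>*\<^sup>* L L'" "threads X L P"
  shows "\<exists>P'. threads X L' P' \<and> (simple_equivalence (prime_divisor_complex X))\<^sup>*\<^sup>* P P'"
  using assms
proof (induction rule: rtranclp_induct)
  case (step M N)
  then show ?case using threads_simple_equivalence by (meson rtranclp_trans)
qed blast

section \<open>Values of the induced map as threadings\<close>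

lemma threads_Cons:
  assumes "L \<noteq> []" "set L \<subseteq> X - {1}" "length W = length L" "prime p" "p dvd hd L"
    and "\<And>i. Suc i < length L \<Longrightarrow> W ! i \<in> eta {L ! i, L ! Suc i}"
    and "last W \<in> eta {last L}"
  shows "threads X L (p # W)"
  using assms
proof (induction L arbitrary: p W)
  case (Cons v L)
  obtain q V where W: "W = q # V" using Cons.prems(3) by (cases W) auto
  show ?case
  proof (cases "L = []")
    case True
    then show ?thesis using Cons.prems W by (auto simp: eta_def)
  next
    case False
    then have "q \<in> eta {v, hd L}" using Cons.prems(6)[of 0] W by (cases L) auto
    then have q: "prime q" "q dvd v" "q dvd hd L" by (auto simp: eta_def)
    have "V \<noteq> []" using False Cons.prems(3) W by auto
    have "threads X L (q # V)"
    proof (rule Cons.IH)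
      show "V ! i \<in> eta {L ! i, L ! Suc i}" if "Suc i < length L" for i
        using Cons.prems(6)[of "Suc i"] that W by simp
      show "last V \<in> eta {last L}" using Cons.prems(7) False W \<open>V \<noteq> []\<close> by simp
    qed (use False Cons.prems(2,3) W q in auto)
    then show ?thesis using Cons.prems W q by auto
  qed
qed simp

lemma threads_simplices:
  assumes "threads X L P" "i < length L"
  shows "length P = Suc (length L) \<and> {P ! i, P ! Suc i} \<in> simplices (prime_divisor_complex X)"
  using assms
proof (induction L arbitrary: P i)
  case (Cons v L)
  then obtain a b R where P: "P = a # b # R" and v: "v \<in> X - {1}" "prime a" "a dvd v"
      "prime b" "b dvd v" and L: "threads X L (b # R)"
    by auto
  have "length R = length L" using L Cons.IH[of "b # R" 0] by (cases L) auto
  moreover have "{P ! i, P ! Suc i} \<in> simplices (prime_divisor_complex X)"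
  proof (cases i)
    case 0
    then show ?thesis using v P by (auto intro: prime_divisors_simplex[of v])
  next
    case (Suc j)
    then show ?thesis using Cons.IH[OF L, of j] Cons.prems(2) P by simp
  qed
  ultimately show ?case using P by simp
qed simp

lemma eta_star_threads:
  assumes L: "edge_path (common_divisor_complex X) L" and W: "eta_star L W"
  shows "threads X L (hd W # W)"
proof (rule threads_Cons)
  have len: "length L \<ge> 2" "length W = length L"
    using L W unfolding edge_path_def eta_star_def by auto
  then have "hd W = W ! 0" "hd L = L ! 0" by (auto intro!: hd_conv_nth)
  moreover have "W ! 0 \<in> eta {L ! 0, L ! Suc 0}" using W len unfolding eta_star_def by simp
  ultimately show "prime (hd W)" "hd W dvd hd L" by (auto simp: eta_def)
qed (use L W in \<open>auto simp: edge_path_def eta_star_def vertices_def common_divisor_complex_def\<close>)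

lemma eta_star_edge_path:
  assumes L: "edge_path (common_divisor_complex X) L" and W: "eta_star L W"
  shows "edge_path (prime_divisor_complex X) W"
proof -
  have len: "length L \<ge> 2" "length W = length L"
    using L W unfolding edge_path_def eta_star_def by auto
  have *: "{(hd W # W) ! i, W ! i} \<in> simplices (prime_divisor_complex X)" if "i < length W" for i
    using threads_simplices[OF eta_star_threads[OF L W], of i] that len by simp
  have "{W ! i, W ! Suc i} \<in> simplices (prime_divisor_complex X)" if "Suc i < length W" for i
    using *[OF that] by simp
  moreover have "W ! i \<in> vertices (prime_divisor_complex X)" if "i < length W" for i
    using *[OF that] unfolding simplices_def vertices_def prime_divisor_complex_def Let_def by auto
  ultimately show ?thesis
    unfolding edge_path_def using len by (auto simp: in_set_conv_nth)
qed

lemma edge_path_duplicate_hd: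
  assumes "edge_path K W"
  shows "(simple_equivalence K)\<^sup>*\<^sup>* W (hd W # W)"
proof -
  have len: "length W \<ge> 2" using assms unfolding edge_path_def by simp
  then obtain a b R where W: "W = a # b # R" by (auto simp: numeral_2_eq_2 Suc_le_length_iff)
  then have "{a, b} \<in> simplices K" using assms unfolding edge_path_def by fastforce
  then have 1: "simple_equivalence K [a, b] [a, a, b]" by (rule simple_equivalence_insert) simp
  show ?thesis
    using simple_equivalences_in_context[OF r_into_rtranclp[of "simple_equivalence K", OF 1], of "[]" R] W
    by simp
qed

theorem theorem4p2:
  fixes X :: "nat set" and L0 L1 W0 W1 :: "nat list"
  assumes "finite X"
    and "\<forall>x \<in> X. x > 0"
    and "connected_complex (common_divisor_complex X)"
    and "homotopic_edge_paths (common_divisor_complex X) L0 L1"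
    and "eta_star L0 W0"
    and "eta_star L1 W1"
    and "hd W0 = hd W1"
    and "last W0 = last W1"
  shows "homotopic_edge_paths (prime_divisor_complex X) W0 W1"
proof -
  let ?D = "prime_divisor_complex X"
  have L: "edge_path (common_divisor_complex X) L0" "edge_path (common_divisor_complex X) L1"
      "(simple_equivalence (common_divisor_complex X))\<^sup>*\<^sup>* L0 L1"
    using assms(4) unfolding homotopic_edge_paths_def by auto
  have W: "edge_path ?D W0" "edge_path ?D W1"
    using L(1,2) assms(5,6) by (auto intro: eta_star_edge_path)
  then have "W0 \<noteq> []" "W1 \<noteq> []" by (auto simp: edge_path_def)
  obtain P where P: "threads X L1 P" "(simple_equivalence ?D)\<^sup>*\<^sup>* (hd W0 # W0) P"
    using threads_simple_equivalences[OF L(3) eta_star_threads[OF L(1) assms(5)]] by blast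
  have "(simple_equivalence ?D)\<^sup>*\<^sup>* W0 (hd W0 # W0)"
    using W(1) by (rule edge_path_duplicate_hd)
  also note P(2)
  also have "(simple_equivalence ?D)\<^sup>*\<^sup>* P (hd W1 # W1)"
  proof (rule threads_unique[OF P(1) eta_star_threads[OF L(2) assms(6)]])
    show "hd P = hd (hd W1 # W1)" "last P = last (hd W1 # W1)"
      using simple_equivalences_same_ends[OF P(2)] assms(7,8) \<open>W0 \<noteq> []\<close> \<open>W1 \<noteq> []\<close> by auto
  qed
  also have "(simple_equivalence ?D)\<^sup>*\<^sup>* (hd W1 # W1) W1"
    using edge_path_duplicate_hd[OF W(2)] by (rule simple_equivalences_sym)
  finally show ?thesis using W unfolding homotopic_edge_paths_def by simp
qed

end
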